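(* $\mathcal{K}_4=\mathcal{K}_4^*$.
   Context: All matroids are finite. $\mathcal{K}_4$ is the class of matroids $M$ (with rank function $r$ and ground set $E(M)$) such that for all subsets $X_1,X_2,X_3,X_4$ of $E(M)$ the fourth Kinser inequality (equivalently, the Ingleton inequality) holds: $$r(X_3)+r(X_4)+r(X_1\cup X_2)+r(X_1\cup X_3\cup X_4)+r(X_2\cup X_3\cup X_4)\leq r(X_1\cup X_3)+r(X_1\cup X_4)+r(X_2\cup X_3)+r(X_2\cup X_4)+r(X_3\cup X_4).$$ $\mathcal{K}_4^*=\{M^*\mid M\in\mathcal{K}_4\}$, where $M^*$ is the dual matroid of $M$. *)

theory Defs
  imports Main
begin

text \<open>
  A matroid is given by its ground set and its family of independent sets. Since
  \<open>is_matroid\<close> confines the independent sets to the ground set, equality of such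
  records is equality of matroids.
\<close>

record 'a matroid =
  ground :: "'a set"
  indeps :: "'a set set"

definition is_matroid :: "'a matroid \<Rightarrow> bool" where
  "is_matroid M \<longleftrightarrow>
     finite (ground M) \<and>
     indeps M \<subseteq> Pow (ground M) \<and>
     {} \<in> indeps M \<and>
     (\<forall>I J. J \<in> indeps M \<longrightarrow> I \<subseteq> J \<longrightarrow> I \<in> indeps M) \<and>
     (\<forall>I J. I \<in> indeps M \<longrightarrow> J \<in> indeps M \<longrightarrow> card I < card J \<longrightarrow>
        (\<exists>x \<in> J - I. insert x I \<in> indeps M))"

definition rank :: "'a matroid \<Rightarrow> 'a set \<Rightarrow> nat" where
  "rank M X = Max (card ` {I \<in> indeps M. I \<subseteq> X})"

definition bases :: "'a matroid \<Rightarrow> 'a set set" where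
  "bases M = {B \<in> indeps M. \<forall>I \<in> indeps M. B \<subseteq> I \<longrightarrow> I = B}"

text \<open>The bases of the dual are the complements of the bases.\<close>

definition dual :: "'a matroid \<Rightarrow> 'a matroid" where
  "dual M = \<lparr>ground = ground M,
             indeps = {I. \<exists>B \<in> bases M. I \<subseteq> ground M - B}\<rparr>"

text \<open>The fourth Kinser inequality, i.e. the Ingleton inequality.\<close>

definition kinser4 :: "'a matroid \<Rightarrow> 'a set \<Rightarrow> 'a set \<Rightarrow> 'a set \<Rightarrow> 'a set \<Rightarrow> bool" where
  "kinser4 M X1 X2 X3 X4 \<longleftrightarrow>
     rank M X3 + rank M X4 + rank M (X1 \<union> X2)
       + rank M (X1 \<union> X3 \<union> X4) + rank M (X2 \<union> X3 \<union> X4)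
     \<le> rank M (X1 \<union> X3) + rank M (X1 \<union> X4) + rank M (X2 \<union> X3)
       + rank M (X2 \<union> X4) + rank M (X3 \<union> X4)"

definition K4 :: "'a matroid set" where
  "K4 = {M. is_matroid M \<and>
     (\<forall>X1 X2 X3 X4. X1 \<subseteq> ground M \<longrightarrow> X2 \<subseteq> ground M \<longrightarrow> X3 \<subseteq> ground M \<longrightarrow> X4 \<subseteq> ground M \<longrightarrow>
        kinser4 M X1 X2 X3 X4)}"

definition K4_dual :: "'a matroid set" where
  "K4_dual = {dual M | M. M \<in> K4}"

end

theory Submission imports Defs begin

text \<open>
  Since the dual of the dual of \<open>M\<close> is \<open>M\<close>, it is enough that \<open>K4\<close> is closed under duality.

  Substituting the formula \<open>r\<^sup>*(X) = |X| + r(E - X) - r(E)\<close> into the Ingleton inequality for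
  \<open>M\<^sup>*\<close> turns unions into intersections of complements, so for general \<open>X\<^sub>1, \<dots>, X\<^sub>4\<close> the outcome is
  not an Ingleton inequality for \<open>M\<close>. It is one when all the intersections \<open>X\<^sub>i \<inter> X\<^sub>j\<close>
  with \<open>i \<noteq> j\<close> are the same set \<open>Z\<close>: then the cardinalities cancel, and what remains is the Ingleton
  inequality of \<open>M\<close> for the complements of the unions of three of the \<open>X\<^sub>i\<close>, with the two pairs
  \<open>{1, 2}\<close> and \<open>{3, 4}\<close> exchanged (\<open>kinser4_dual_if_equal_intersections\<close>).

  The general case reduces to this one inside \<open>M\<^sup>*\<close>. If an element \<open>e\<close> lies in at least two of the
  sets \<open>X\<^sub>i\<close>, then adding it to all four can only make the Ingleton inequality harder to satisfy
  (\<open>kinser4_if_kinser4_insert\<close>); this is a consequence of submodularity alone. Taking for \<open>Z\<close> the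
  set of all elements that lie in at least two of the \<open>X\<^sub>i\<close>, the sets \<open>X\<^sub>i \<union> Z\<close> intersect pairwise
  in exactly \<open>Z\<close>.
\<close>

section \<open>Rank and bases\<close>

lemma finite_ground: "is_matroid M \<Longrightarrow> finite (ground M)"
  by (simp add: is_matroid_def)

lemma indep_subset_ground: "is_matroid M \<Longrightarrow> I \<in> indeps M \<Longrightarrow> I \<subseteq> ground M"
  by (auto simp: is_matroid_def)

lemma finite_indep: "is_matroid M \<Longrightarrow> I \<in> indeps M \<Longrightarrow> finite I"
  using finite_ground finite_subset indep_subset_ground by metis

lemma indep_subset:
  assumes "is_matroid M" "J \<in> indeps M" "I \<subseteq> J"
  shows "I \<in> indeps M"
proof -
  have "\<forall>I J. J \<in> indeps M \<longrightarrow> I \<subseteq> J \<longrightarrow> I \<in> indeps M"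
    using assms(1) unfolding is_matroid_def by (elim conjE)
  then show ?thesis
    using assms by blast
qed

lemma indep_augment:
  assumes "is_matroid M" "I \<in> indeps M" "J \<in> indeps M" "card I < card J"
  obtains x where "x \<in> J - I" "insert x I \<in> indeps M"
proof -
  have "\<forall>I J. I \<in> indeps M \<longrightarrow> J \<in> indeps M \<longrightarrow> card I < card J \<longrightarrow>
      (\<exists>x\<in>J - I. insert x I \<in> indeps M)"
    using assms(1) unfolding is_matroid_def by (elim conjE)
  then show thesis
    using assms that by blast
qed

lemma finite_indeps: "is_matroid M \<Longrightarrow> finite (indeps M)"
  using finite_ground indep_subset_ground finite_subset[of "indeps M" "Pow (ground M)"] by blast

lemma card_le_rank:
  assumes "is_matroid M" "I \<in> indeps M" "I \<subseteq> X"
  shows "card I \<le> rank M X"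
  unfolding rank_def using assms finite_indeps[OF assms(1)] by (intro Max_ge) auto

lemma rank_attained:
  assumes "is_matroid M"
  obtains I where "I \<in> indeps M" "I \<subseteq> X" "card I = rank M X"
proof -
  have "{} \<in> {I \<in> indeps M. I \<subseteq> X}"
    using assms by (simp add: is_matroid_def)
  then have "rank M X \<in> card ` {I \<in> indeps M. I \<subseteq> X}"
    unfolding rank_def using finite_indeps[OF assms] by (intro Max_in) auto
  then show thesis
    using that by auto
qed

lemma rank_mono:
  assumes "is_matroid M" "X \<subseteq> Y"
  shows "rank M X \<le> rank M Y"
  using assms by (metis card_le_rank order_trans rank_attained)

lemma indep_extend:
  assumes M: "is_matroid M" and I: "I \<in> indeps M" "I \<subseteq> X"
  obtains J where "J \<in> indeps M" "I \<subseteq> J" "J \<subseteq> X" "card J = rank M X"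
proof -
  let ?P = "\<lambda>J. J \<in> indeps M \<and> I \<subseteq> J \<and> J \<subseteq> X"
  have "\<forall>J. ?P J \<longrightarrow> card J < Suc (rank M X)"
    using card_le_rank[OF M] by (simp add: le_imp_less_Suc)
  then obtain J where J: "?P J" and max: "\<And>K. ?P K \<Longrightarrow> card K \<le> card J"
    using ex_has_greatest_nat[of ?P I card "Suc (rank M X)"] I by blast
  have "\<not> card J < rank M X"
  proof
    assume less: "card J < rank M X"
    obtain K where K: "K \<in> indeps M" "K \<subseteq> X" "card K = rank M X"
      using rank_attained[OF M] .
    with less J obtain x where x: "x \<in> K - J" "insert x J \<in> indeps M"
      using indep_augment[OF M, of J K] by auto
    then have "card (insert x J) \<le> card J"
      using J K by (intro max) auto
    then show False
      using x finite_indep[OF M] J by auto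
  qed
  then have "card J = rank M X"
    using card_le_rank[OF M] J by (meson le_neq_implies_less)
  then show thesis
    using that J by blast
qed

text \<open>
  An independent set that attains the rank on \<open>A \<inter> B\<close> extends to one, \<open>J\<close>, that attains it on
  \<open>A \<union> B\<close>; the sets \<open>J \<inter> A\<close> and \<open>J \<inter> B\<close> bound the two ranks on the right from below.
\<close>

lemma rank_submodular:
  assumes M: "is_matroid M"
  shows "rank M (A \<union> B) + rank M (A \<inter> B) \<le> rank M A + rank M B"
proof -
  obtain I where I: "I \<in> indeps M" "I \<subseteq> A \<inter> B" "card I = rank M (A \<inter> B)"
    using rank_attained[OF M] .
  then obtain J where J: "J \<in> indeps M" "I \<subseteq> J" "J \<subseteq> A \<union> B" "card J = rank M (A \<union> B)"
    using indep_extend[OF M, of I "A \<union> B"] by auto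
  have fin: "finite J"
    using finite_indep[OF M J(1)] .
  have "card (J \<inter> A) + card (J \<inter> B) = card (J \<inter> A \<union> J \<inter> B) + card ((J \<inter> A) \<inter> (J \<inter> B))"
    using fin by (intro card_Un_Int) auto
  moreover have "J \<inter> A \<union> J \<inter> B = J"
    using J by auto
  moreover have "card I \<le> card ((J \<inter> A) \<inter> (J \<inter> B))"
    using fin I J by (intro card_mono) auto
  ultimately have "rank M (A \<union> B) + rank M (A \<inter> B) \<le> card (J \<inter> A) + card (J \<inter> B)"
    using I J by simp
  moreover have "card (J \<inter> A) \<le> rank M A" "card (J \<inter> B) \<le> rank M B"
    using J indep_subset[OF M J(1)] by (auto intro!: card_le_rank[OF M])
  ultimately show ?thesis
    by linarith
qed

lemma rank_insert_diminishing:
  assumes M: "is_matroid M" and "S \<subseteq> T"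
  shows "rank M (insert e T) + rank M S \<le> rank M (insert e S) + rank M T"
proof (cases "e \<in> T")
  case True
  then show ?thesis
    using rank_mono[OF M, of S "insert e S"] by (simp add: insert_absorb subset_insertI)
next
  case False
  then have "insert e S \<union> T = insert e T" "insert e S \<inter> T = S"
    using assms by auto
  then show ?thesis
    using rank_submodular[OF M, of "insert e S" T] by simp
qed

lemma bases_iff_card:
  assumes M: "is_matroid M"
  shows "B \<in> bases M \<longleftrightarrow> B \<in> indeps M \<and> card B = rank M (ground M)"
proof
  assume "B \<in> bases M"
  then have B: "B \<in> indeps M" "\<And>I. I \<in> indeps M \<Longrightarrow> B \<subseteq> I \<Longrightarrow> I = B"
    by (auto simp: bases_def)
  obtain J where "J \<in> indeps M" "B \<subseteq> J" "card J = rank M (ground M)"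
    using indep_extend[OF M B(1) indep_subset_ground[OF M B(1)]] .
  then show "B \<in> indeps M \<and> card B = rank M (ground M)"
    using B by metis
next
  assume B: "B \<in> indeps M \<and> card B = rank M (ground M)"
  have "I = B" if "I \<in> indeps M" "B \<subseteq> I" for I
    using that B card_le_rank[OF M that(1) indep_subset_ground[OF M that(1)]]
      finite_indep[OF M that(1)] card_seteq by metis
  then show "B \<in> bases M"
    using B by (auto simp: bases_def)
qed

lemma base_extend:
  assumes M: "is_matroid M" and I: "I \<in> indeps M"
  obtains B where "B \<in> bases M" "I \<subseteq> B"
  using indep_extend[OF M I indep_subset_ground[OF M I]] bases_iff_card[OF M] by metis

lemma base_subset_ground: "is_matroid M \<Longrightarrow> B \<in> bases M \<Longrightarrow> B \<subseteq> ground M"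
  by (simp add: bases_iff_card indep_subset_ground)


section \<open>The dual matroid\<close>

lemma ground_dual [simp]: "ground (dual M) = ground M"
  by (simp add: dual_def)

lemma indeps_dual_iff: "I \<in> indeps (dual M) \<longleftrightarrow> (\<exists>B\<in>bases M. I \<subseteq> ground M - B)"
  by (simp add: dual_def)

text \<open>
  Given a base \<open>B\<close> that avoids \<open>J\<close>, the set \<open>B - I\<close> extends to a base \<open>B'\<close> that avoids \<open>I\<close>. As
  \<open>B'\<close> has the same size as \<open>B\<close>, it has no room for all of \<open>J - I\<close> when \<open>J\<close> is larger than \<open>I\<close>, and
  any element of \<open>J - I\<close> outside \<open>B'\<close> augments \<open>I\<close>.
\<close>

lemma dual_augment:
  assumes M: "is_matroid M" and I: "I \<in> indeps (dual M)" and J: "J \<in> indeps (dual M)"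
    and less: "card I < card J"
  shows "\<exists>x\<in>J - I. insert x I \<in> indeps (dual M)"
proof -
  obtain B where B: "B \<in> bases M" "J \<subseteq> ground M - B"
    using J indeps_dual_iff by metis
  obtain A where A: "A \<in> bases M" "I \<subseteq> ground M - A"
    using I indeps_dual_iff by metis
  have fin: "finite I" "finite J" "finite B"
    using A B finite_ground[OF M] base_subset_ground[OF M B(1)] finite_subset by blast+
  have "B - I \<in> indeps M" "B - I \<subseteq> ground M - I"
    using B bases_iff_card[OF M] indep_subset[OF M] base_subset_ground[OF M] by blast+
  then obtain B' where B': "B' \<in> indeps M" "B - I \<subseteq> B'" "B' \<subseteq> ground M - I"
    "card B' = rank M (ground M - I)"
    using indep_extend[OF M] by metis
  \<comment> \<open>The base \<open>A\<close> avoids \<open>I\<close>, so removing \<open>I\<close> from the ground set does not lower the rank.\<close>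
  have "card A \<le> rank M (ground M - I)"
    using A bases_iff_card[OF M] base_subset_ground[OF M] by (intro card_le_rank[OF M]) blast+
  then have card_B': "card B' = rank M (ground M)"
    using A B'(4) bases_iff_card[OF M] rank_mono[OF M, of "ground M - I" "ground M"] by auto
  then have base: "B' \<in> bases M"
    using B' bases_iff_card[OF M] by blast
  have "\<not> J - I \<subseteq> B'"
  proof
    assume "J - I \<subseteq> B'"
    then have "card ((B - I) \<union> (J - I)) \<le> card B'"
      using B' finite_indep[OF M] by (intro card_mono) auto
    moreover have "card ((B - I) \<union> (J - I)) = card (B - I) + card (J - I)"
      using B fin by (intro card_Un_disjoint) auto
    moreover have "card B = card (B - I) + card (B \<inter> I)"
      using fin card_Diff_subset_Int[of B I] card_mono[of B "B \<inter> I"] by simp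
    moreover have "card (B \<inter> I) \<le> card (I - J)"
      using B fin by (intro card_mono) auto
    moreover have "card (I - J) < card (J - I)"
      using less fin by (simp add: card_less_sym_Diff)
    moreover have "card B = card B'"
      using B card_B' bases_iff_card[OF M] by simp
    ultimately show False
      by linarith
  qed
  then obtain x where "x \<in> J - I" "x \<notin> B'"
    by blast
  moreover have "insert x I \<subseteq> ground M - B'"
    using calculation B B' A by blast
  ultimately show ?thesis
    using base indeps_dual_iff by metis
qed

lemma is_matroid_dual:
  assumes M: "is_matroid M"
  shows "is_matroid (dual M)"
proof -
  have "{} \<in> indeps M"
    using M by (simp add: is_matroid_def)
  then obtain B where "B \<in> bases M"
    using base_extend[OF M] by metis
  then have "{} \<in> indeps (dual M)"
    using indeps_dual_iff by blast
  moreover have "indeps (dual M) \<subseteq> Pow (ground M)"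
    by (auto simp: indeps_dual_iff)
  moreover have "\<forall>I J. J \<in> indeps (dual M) \<longrightarrow> I \<subseteq> J \<longrightarrow> I \<in> indeps (dual M)"
    unfolding indeps_dual_iff by (meson subset_trans)
  moreover have "\<forall>I J. I \<in> indeps (dual M) \<longrightarrow> J \<in> indeps (dual M) \<longrightarrow> card I < card J \<longrightarrow>
      (\<exists>x\<in>J - I. insert x I \<in> indeps (dual M))"
    by (intro allI impI) (rule dual_augment[OF M])
  ultimately show ?thesis
    unfolding is_matroid_def ground_dual using finite_ground[OF M] by (intro conjI)
qed

lemma bases_dual:
  assumes M: "is_matroid M"
  shows "bases (dual M) = (\<lambda>B. ground M - B) ` bases M"
proof (intro subset_antisym subsetI)
  fix C assume "C \<in> bases (dual M)"
  then have C: "C \<in> indeps (dual M)" "\<And>I. I \<in> indeps (dual M) \<Longrightarrow> C \<subseteq> I \<Longrightarrow> I = C"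
    by (auto simp: bases_def)
  then obtain B where B: "B \<in> bases M" "C \<subseteq> ground M - B"
    using indeps_dual_iff by metis
  then have "ground M - B = C"
    using C(2) indeps_dual_iff by blast
  then show "C \<in> (\<lambda>B. ground M - B) ` bases M"
    using B by blast
next
  fix C assume "C \<in> (\<lambda>B. ground M - B) ` bases M"
  then obtain B where B: "B \<in> bases M" "C = ground M - B"
    by blast
  have "I = C" if "I \<in> indeps (dual M)" "C \<subseteq> I" for I
  proof -
    obtain B' where B': "B' \<in> bases M" "I \<subseteq> ground M - B'"
      using \<open>I \<in> indeps (dual M)\<close> indeps_dual_iff by metis
    then have "B' \<subseteq> B"
      using B \<open>C \<subseteq> I\<close> base_subset_ground[OF M B'(1)] by blast
    then have "B' = B"
      using B B' by (auto simp: bases_def)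
    then show ?thesis
      using B B' \<open>C \<subseteq> I\<close> by blast
  qed
  moreover have "C \<in> indeps (dual M)"
    using B indeps_dual_iff by blast
  ultimately show "C \<in> bases (dual M)"
    by (auto simp: bases_def)
qed

lemma dual_dual:
  fixes M :: "'a matroid"
  assumes M: "is_matroid M"
  shows "dual (dual M) = M"
proof (rule matroid.equality)
  have "I \<in> indeps (dual (dual M)) \<longleftrightarrow> I \<in> indeps M" for I
  proof -
    have "I \<in> indeps (dual (dual M)) \<longleftrightarrow> (\<exists>B\<in>bases M. I \<subseteq> ground M - (ground M - B))"
      by (simp add: indeps_dual_iff bases_dual[OF M])
    also have "\<dots> \<longleftrightarrow> (\<exists>B\<in>bases M. I \<subseteq> B)"
      using base_subset_ground[OF M] by blast
    also have "\<dots> \<longleftrightarrow> I \<in> indeps M"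
      using base_extend[OF M] indep_subset[OF M] bases_iff_card[OF M] by metis
    finally show ?thesis .
  qed
  then show "indeps (dual (dual M)) = indeps M"
    by blast
qed simp_all

text \<open>
  The rank of \<open>X\<close> in the dual is the largest size of \<open>X - B\<close> over all bases \<open>B\<close> of \<open>M\<close>. It
  is achieved by a base with as many elements as possible outside \<open>X\<close>, that is, by
  one that extends an independent subset of \<open>E - X\<close> of maximal size.
\<close>

lemma rank_dual:
  assumes M: "is_matroid M" and X: "X \<subseteq> ground M"
  shows "rank (dual M) X + rank M (ground M) = card X + rank M (ground M - X)"
proof (rule antisym)
  note finX = finite_subset[OF X finite_ground[OF M]]
  have card_split: "card X = card (X - B) + card (B \<inter> X)" for B
    using finX card_Diff_subset_Int[of X B] card_mono[of X "X \<inter> B"] by (simp add: Int_commute)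
  have base_split: "card B = card (B \<inter> X) + card (B - X)" if "B \<in> bases M" for B
    using that finite_indep[OF M] bases_iff_card[OF M] card_Diff_subset_Int[of B X]
      card_mono[of B "B \<inter> X"] by simp
  have base_outside: "card (B - X) \<le> rank M (ground M - X)" if "B \<in> bases M" for B
  proof (rule card_le_rank[OF M])
    show "B - X \<in> indeps M"
      using that bases_iff_card[OF M, of B] indep_subset[OF M, of B "B - X"] by simp
    show "B - X \<subseteq> ground M - X"
      using base_subset_ground[OF M that] by blast
  qed

  show "rank (dual M) X + rank M (ground M) \<le> card X + rank M (ground M - X)"
  proof -
    obtain I where I: "I \<in> indeps (dual M)" "I \<subseteq> X" "card I = rank (dual M) X"
      using rank_attained[OF is_matroid_dual[OF M]] .
    then obtain B where B: "B \<in> bases M" "I \<subseteq> ground M - B"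
      using indeps_dual_iff by metis
    have "card I \<le> card (X - B)"
      using I B finX by (intro card_mono) auto
    then show ?thesis
      using I card_split[of B] base_split[OF B(1)] base_outside[OF B(1)]
        B(1) bases_iff_card[OF M, of B] by linarith
  qed

  show "card X + rank M (ground M - X) \<le> rank (dual M) X + rank M (ground M)"
  proof -
    obtain J where J: "J \<in> indeps M" "J \<subseteq> ground M - X" "card J = rank M (ground M - X)"
      using rank_attained[OF M] .
    obtain B where B: "B \<in> bases M" "J \<subseteq> B"
      using base_extend[OF M J(1)] .
    have "card J \<le> card (B - X)"
      using J B finite_indep[OF M] bases_iff_card[OF M] by (intro card_mono) auto
    moreover have "card (X - B) \<le> rank (dual M) X"
      using B X by (intro card_le_rank[OF is_matroid_dual[OF M]]) (auto simp: indeps_dual_iff)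
    ultimately show ?thesis
      using J card_split[of B] base_split[OF B(1)]
        B(1) bases_iff_card[OF M, of B] by linarith
  qed
qed


section \<open>Reduction to equal pairwise intersections\<close>

text \<open>
  Inserting \<open>e\<close> changes only the ranks of those unions that do not contain \<open>e\<close> already. When
  \<open>e\<close> lies in two of the sets, at most one term on the larger side of the inequality is among them:
  \<open>X\<^sub>3 \<union> X\<^sub>4\<close>, or \<open>X\<^sub>i \<union> X\<^sub>j\<close> with \<open>i \<in> {1, 2}\<close> and \<open>j \<in> {3, 4}\<close>. Then the term \<open>X\<^sub>3\<close> or \<open>X\<^sub>4\<close> that is
  contained in this union is affected as well, and by diminishing returns it grows at least as much.
\<close>

lemma kinser4_if_kinser4_insert:
  assumes M: "is_matroid M"
    and e: "e \<in> X1 \<inter> X2 \<union> X1 \<inter> X3 \<union> X1 \<inter> X4 \<union> X2 \<inter> X3 \<union> X2 \<inter> X4 \<union> X3 \<inter> X4"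
    and ins: "kinser4 M (insert e X1) (insert e X2) (insert e X3) (insert e X4)"
  shows "kinser4 M X1 X2 X3 X4"
proof -
  let ?r = "rank M"
  have diminishing:
    "?r (insert e (X1 \<union> X3)) + ?r X3 \<le> ?r (insert e X3) + ?r (X1 \<union> X3)"
    "?r (insert e (X2 \<union> X3)) + ?r X3 \<le> ?r (insert e X3) + ?r (X2 \<union> X3)"
    "?r (insert e (X3 \<union> X4)) + ?r X3 \<le> ?r (insert e X3) + ?r (X3 \<union> X4)"
    "?r (insert e (X1 \<union> X4)) + ?r X4 \<le> ?r (insert e X4) + ?r (X1 \<union> X4)"
    "?r (insert e (X2 \<union> X4)) + ?r X4 \<le> ?r (insert e X4) + ?r (X2 \<union> X4)"
    by (intro rank_insert_diminishing[OF M]; blast)+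
  have mono:
    "?r X3 \<le> ?r (insert e X3)" "?r X4 \<le> ?r (insert e X4)"
    "?r (X1 \<union> X2) \<le> ?r (insert e (X1 \<union> X2))"
    "?r (X1 \<union> X3 \<union> X4) \<le> ?r (insert e (X1 \<union> X3 \<union> X4))"
    "?r (X2 \<union> X3 \<union> X4) \<le> ?r (insert e (X2 \<union> X3 \<union> X4))"
    by (intro rank_mono[OF M]; blast)+
  have ins':
    "?r (insert e X3) + ?r (insert e X4) + ?r (insert e (X1 \<union> X2))
       + ?r (insert e (X1 \<union> X3 \<union> X4)) + ?r (insert e (X2 \<union> X3 \<union> X4))
     \<le> ?r (insert e (X1 \<union> X3)) + ?r (insert e (X1 \<union> X4)) + ?r (insert e (X2 \<union> X3))
       + ?r (insert e (X2 \<union> X4)) + ?r (insert e (X3 \<union> X4))"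
    using ins by (simp add: kinser4_def)
  have absorb: "insert e X = X" if "e \<in> X" for X
    using that by blast
  consider "e \<in> X1" "e \<in> X2" | "e \<in> X1" "e \<in> X3" | "e \<in> X1" "e \<in> X4"
    | "e \<in> X2" "e \<in> X3" | "e \<in> X2" "e \<in> X4" | "e \<in> X3" "e \<in> X4"
    using e by blast
  then show ?thesis
    using ins' mono diminishing unfolding kinser4_def
    by cases (simp_all add: absorb)
qed

lemma kinser4_if_kinser4_Un:
  assumes M: "is_matroid M" and "finite Z"
    and "Z \<subseteq> X1 \<inter> X2 \<union> X1 \<inter> X3 \<union> X1 \<inter> X4 \<union> X2 \<inter> X3 \<union> X2 \<inter> X4 \<union> X3 \<inter> X4"
    and "kinser4 M (X1 \<union> Z) (X2 \<union> Z) (X3 \<union> Z) (X4 \<union> Z)"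
  shows "kinser4 M X1 X2 X3 X4"
  using assms(2-)
proof (induction Z rule: finite_induct)
  case empty
  then show ?case
    by simp
next
  case (insert e Z)
  have "kinser4 M (X1 \<union> Z) (X2 \<union> Z) (X3 \<union> Z) (X4 \<union> Z)"
  proof (rule kinser4_if_kinser4_insert[OF M])
    show "e \<in> (X1 \<union> Z) \<inter> (X2 \<union> Z) \<union> (X1 \<union> Z) \<inter> (X3 \<union> Z) \<union> (X1 \<union> Z) \<inter> (X4 \<union> Z)
      \<union> (X2 \<union> Z) \<inter> (X3 \<union> Z) \<union> (X2 \<union> Z) \<inter> (X4 \<union> Z) \<union> (X3 \<union> Z) \<inter> (X4 \<union> Z)"
      using insert.prems(1) by blast
  qed (use insert.prems(2) in simp)
  then show ?case
    using insert by simp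
qed


section \<open>Closure under duality\<close>

text \<open>
  With equal pairwise intersections, the union of any one, two or three of the complements of triple
  unions is the complement of a union of some \<open>X\<^sub>i\<close>; for instance \<open>(X\<^sub>1 \<union> X\<^sub>2 \<union> X\<^sub>4) \<inter> (X\<^sub>2 \<union> X\<^sub>3 \<union> X\<^sub>4)\<close> is
  \<open>X\<^sub>2 \<union> X\<^sub>4\<close> because \<open>X\<^sub>1 \<inter> X\<^sub>3 \<subseteq> X\<^sub>2\<close>. So the ten ranks in the Ingleton inequality for the
  complements are exactly the ranks \<open>r(E - X)\<close> that the dual inequality calls for.
\<close>

lemma kinser4_dual_if_equal_intersections:
  assumes M: "M \<in> K4"
    and sub: "X1 \<subseteq> ground M" "X2 \<subseteq> ground M" "X3 \<subseteq> ground M" "X4 \<subseteq> ground M"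
    and int: "X1 \<inter> X2 = Z" "X1 \<inter> X3 = Z" "X1 \<inter> X4 = Z" "X2 \<inter> X3 = Z" "X2 \<inter> X4 = Z" "X3 \<inter> X4 = Z"
  shows "kinser4 (dual M) X1 X2 X3 X4"
proof -
  have mat: "is_matroid M"
    using M by (simp add: K4_def)
  let ?E = "ground M"
  let ?r = "rank M"
  define Y1 where "Y1 = ?E - (X1 \<union> X2 \<union> X4)"
  define Y2 where "Y2 = ?E - (X1 \<union> X2 \<union> X3)"
  define Y3 where "Y3 = ?E - (X2 \<union> X3 \<union> X4)"
  define Y4 where "Y4 = ?E - (X1 \<union> X3 \<union> X4)"
  have in_two_in_all:
    "X1 \<inter> X3 \<subseteq> X2 \<inter> X4" "X1 \<inter> X4 \<subseteq> X2 \<inter> X3" "X2 \<inter> X3 \<subseteq> X1 \<inter> X4" "X2 \<inter> X4 \<subseteq> X1 \<inter> X3"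
    "X1 \<inter> X2 \<subseteq> X3 \<inter> X4" "X3 \<inter> X4 \<subseteq> X1 \<inter> X2"
    by (simp_all only: int subset_refl)
  have unions:
    "Y1 \<union> Y2 = ?E - (X1 \<union> X2)" "Y1 \<union> Y3 \<union> Y4 = ?E - X4" "Y2 \<union> Y3 \<union> Y4 = ?E - X3"
    "Y1 \<union> Y3 = ?E - (X2 \<union> X4)" "Y1 \<union> Y4 = ?E - (X1 \<union> X4)" "Y2 \<union> Y3 = ?E - (X2 \<union> X3)"
    "Y2 \<union> Y4 = ?E - (X1 \<union> X3)" "Y3 \<union> Y4 = ?E - (X3 \<union> X4)"
    unfolding Y1_def Y2_def Y3_def Y4_def using in_two_in_all by blast+
  have "kinser4 M Y1 Y2 Y3 Y4"
    using M by (simp add: K4_def Y1_def Y2_def Y3_def Y4_def Diff_subset)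
  then have primal:
    "?r (?E - (X2 \<union> X3 \<union> X4)) + ?r (?E - (X1 \<union> X3 \<union> X4)) + ?r (?E - (X1 \<union> X2))
       + ?r (?E - X4) + ?r (?E - X3)
     \<le> ?r (?E - (X2 \<union> X4)) + ?r (?E - (X1 \<union> X4)) + ?r (?E - (X2 \<union> X3))
       + ?r (?E - (X1 \<union> X3)) + ?r (?E - (X3 \<union> X4))"
    unfolding kinser4_def unions(2,3) unfolding unions(1,4-8) unfolding Y3_def Y4_def .
  have fin: "finite X1" "finite X2" "finite X3" "finite X4"
    using sub finite_ground[OF mat] finite_subset by blast+
  have triple: "(X1 \<union> X3) \<inter> X4 = Z" "(X2 \<union> X3) \<inter> X4 = Z"
    by (simp_all add: Int_Un_distrib2 int)
  have cards:
    "card X1 + card X2 = card (X1 \<union> X2) + card Z"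
    "card X1 + card X3 = card (X1 \<union> X3) + card Z"
    "card X1 + card X4 = card (X1 \<union> X4) + card Z"
    "card X2 + card X3 = card (X2 \<union> X3) + card Z"
    "card X2 + card X4 = card (X2 \<union> X4) + card Z"
    "card X3 + card X4 = card (X3 \<union> X4) + card Z"
    "card (X1 \<union> X3) + card X4 = card (X1 \<union> X3 \<union> X4) + card Z"
    "card (X2 \<union> X3) + card X4 = card (X2 \<union> X3 \<union> X4) + card Z"
    using card_Un_Int[of X1 X2] card_Un_Int[of X1 X3] card_Un_Int[of X1 X4]
      card_Un_Int[of X2 X3] card_Un_Int[of X2 X4] card_Un_Int[of X3 X4]
      card_Un_Int[of "X1 \<union> X3" X4] card_Un_Int[of "X2 \<union> X3" X4]
    unfolding int triple using fin by auto
  note dual_ranks = rank_dual[OF mat sub(3)] rank_dual[OF mat sub(4)]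
    rank_dual[OF mat Un_least[OF sub(1,2)]] rank_dual[OF mat Un_least[OF sub(1,3)]]
    rank_dual[OF mat Un_least[OF sub(1,4)]] rank_dual[OF mat Un_least[OF sub(2,3)]]
    rank_dual[OF mat Un_least[OF sub(2,4)]] rank_dual[OF mat Un_least[OF sub(3,4)]]
    rank_dual[OF mat Un_least[OF Un_least[OF sub(1,3)] sub(4)]]
    rank_dual[OF mat Un_least[OF Un_least[OF sub(2,3)] sub(4)]]
  show ?thesis
    unfolding kinser4_def using primal cards dual_ranks by linarith
qed

lemma dual_in_K4:
  assumes M: "M \<in> K4"
  shows "dual M \<in> K4"
proof -
  have mat: "is_matroid M"
    using M by (simp add: K4_def)
  have "kinser4 (dual M) X1 X2 X3 X4"
    if sub: "X1 \<subseteq> ground M" "X2 \<subseteq> ground M" "X3 \<subseteq> ground M" "X4 \<subseteq> ground M" for X1 X2 X3 X4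
  proof -
    define Z where "Z = X1 \<inter> X2 \<union> X1 \<inter> X3 \<union> X1 \<inter> X4 \<union> X2 \<inter> X3 \<union> X2 \<inter> X4 \<union> X3 \<inter> X4"
    have Z: "Z \<subseteq> ground M"
      using sub unfolding Z_def by blast
    have "kinser4 (dual M) (X1 \<union> Z) (X2 \<union> Z) (X3 \<union> Z) (X4 \<union> Z)"
      by (rule kinser4_dual_if_equal_intersections[OF M, where Z = Z])
        (use sub Z in \<open>auto simp: Z_def\<close>)
    moreover have "finite Z"
      using Z finite_ground[OF mat] finite_subset by blast
    ultimately show ?thesis
      using kinser4_if_kinser4_Un[OF is_matroid_dual[OF mat], of Z X1 X2 X3 X4]
      by (simp add: Z_def)
  qed
  then show ?thesis
    using is_matroid_dual[OF mat] by (simp add: K4_def)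
qed

theorem lemma4p5: "(K4 :: 'a matroid set) = K4_dual"
proof (intro subset_antisym subsetI)
  fix M :: "'a matroid"
  assume M: "M \<in> K4"
  then have "M = dual (dual M)"
    by (simp add: K4_def dual_dual)
  then show "M \<in> K4_dual"
    using dual_in_K4[OF M] unfolding K4_dual_def by blast
next
  fix M :: "'a matroid"
  assume "M \<in> K4_dual"
  then show "M \<in> K4"
    using dual_in_K4 unfolding K4_dual_def by blast
qed

end
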